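(* Let $\mathcal{H}$ be a real Hilbert space. For $i\in\{1,2\}$ let $\gamma_i\in[0,1[$ and let $G_i:\mathcal{H}\to\mathcal{H}$ be a $\gamma_i$-BAM such that $\operatorname{Fix}G_i$ is a closed linear subspace of $\mathcal{H}$. Suppose that $\operatorname{Fix}G_1+\operatorname{Fix}G_2$ is closed. Let $\alpha\in\,]0,1[$. Set $c_F:=c(\operatorname{Fix}G_1,\operatorname{Fix}G_2)$ (the cosine of the Friedrichs angle) and $$\gamma:=\max\left\{\alpha\sqrt{\gamma_1^2+(1-\gamma_1^2)\tfrac{1+c_F}{2}}+(1-\alpha),\ \alpha+(1-\alpha)\sqrt{\gamma_2^2+(1-\gamma_2^2)\tfrac{1+c_F}{2}}\right\}.$$ Then $$\max\left\{\alpha\sqrt{\tfrac12(1+\gamma_1^2)}+(1-\alpha),\ \alpha+(1-\alpha)\sqrt{\tfrac12(1+\gamma_2^2)}\right\}\le\gamma<1$$ and $\alpha G_1+(1-\alpha)G_2$ is a $\gamma$-BAM.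
   Context: For a nonempty closed convex set $C\subseteq\mathcal{H}$, $\mathrm{P}_C$ denotes the metric projection onto $C$. $\operatorname{Fix}G=\{x\in\mathcal{H}: Gx=x\}$. Definition (BAM). Let $G:\mathcal{H}\to\mathcal{H}$ and $\gamma\in[0,1[$. $G$ is a best approximation mapping with constant $\gamma$ ($\gamma$-BAM) if (1) $\operatorname{Fix}G$ is a nonempty closed convex subset of $\mathcal{H}$; (2) $\mathrm{P}_{\operatorname{Fix}G}G=\mathrm{P}_{\operatorname{Fix}G}$; (3) $\|Gx-\mathrm{P}_{\operatorname{Fix}G}x\|\le\gamma\|x-\mathrm{P}_{\operatorname{Fix}G}x\|$ for all $x\in\mathcal{H}$. Friedrichs angle: for linear subspaces $U,V$ of $\mathcal{H}$, $c(U,V):=\sup\{|\langle u,v\rangle| : u\in U\cap(U\cap V)^\perp,\ v\in V\cap(U\cap V)^\perp,\ \|u\|\le1,\ \|v\|\le1\}$. *)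

theory Defs
  imports "HOL-Analysis.Analysis"
begin

definition Fix :: "('a \<Rightarrow> 'a) \<Rightarrow> 'a set"
  where "Fix G = {x. G x = x}"

text \<open>
  Same defining property as \<^const>\<open>closest_point\<close>, which is not usable here because its type
  is restricted to the class \<^class>\<open>heine_borel\<close>, i.e. to the finite-dimensional case.
  In a Hilbert space the minimiser exists and is unique for nonempty closed convex \<open>C\<close>;
  for other \<open>C\<close> the value carries no meaning.
\<close>

definition metric_proj :: "'a::real_inner set \<Rightarrow> 'a \<Rightarrow> 'a"
  where "metric_proj C x = (SOME p. p \<in> C \<and> (\<forall>y\<in>C. dist x p \<le> dist x y))"

text \<open>Best approximation mapping with constant \<open>\<gamma>\<close>.\<close>

definition is_BAM :: "real \<Rightarrow> ('a::{real_inner,complete_space} \<Rightarrow> 'a) \<Rightarrow> bool"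
  where "is_BAM \<gamma> G \<longleftrightarrow>
    \<gamma> \<in> {0..<1} \<and>
    Fix G \<noteq> {} \<and> closed (Fix G) \<and> convex (Fix G) \<and>
    metric_proj (Fix G) \<circ> G = metric_proj (Fix G) \<and>
    (\<forall>x. norm (G x - metric_proj (Fix G) x) \<le> \<gamma> * norm (x - metric_proj (Fix G) x))"

text \<open>
  The cosine \<open>c(U,V)\<close> of the Friedrichs angle. For subspaces the set below contains \<open>0\<close> and is
  bounded above by \<open>1\<close>, so the conditionally complete \<^const>\<open>Sup\<close> on the reals is the supremum.
\<close>

definition friedrichs_cos :: "'a::real_inner set \<Rightarrow> 'a set \<Rightarrow> real"
  where "friedrichs_cos U V =
    Sup {\<bar>u \<bullet> v\<bar> | u v. u \<in> U \<inter> (U \<inter> V)\<^sup>\<bottom> \<and> v \<in> V \<inter> (U \<inter> V)\<^sup>\<bottom> \<and> norm u \<le> 1 \<and> norm v \<le> 1}"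

end

theory Submission
  imports Defs
begin

text \<open>
  Let \<open>U\<close>, \<open>V\<close> be the two fixed point spaces, \<open>W = U \<inter> V\<close>, and \<open>z = x - w\<close> with \<open>w\<close> the projection
  of \<open>x\<close> onto \<open>W\<close>. Since \<open>G\<^sub>i x\<close> differs from the projection of \<open>x\<close> by a vector orthogonal to the
  fixed point space, Pythagoras gives
  \<open>\<parallel>G\<^sub>1 x - w\<parallel>\<^sup>2 \<le> \<gamma>\<^sub>1\<^sup>2 \<parallel>z\<parallel>\<^sup>2 + (1 - \<gamma>\<^sub>1\<^sup>2) \<parallel>P\<^sub>U z\<parallel>\<^sup>2\<close>, and likewise for \<open>G\<^sub>2\<close>.
  From \<open>\<parallel>P\<^sub>U z\<parallel>\<^sup>2 + \<parallel>P\<^sub>V z\<parallel>\<^sup>2 \<le> (1 + c\<^sub>F) \<parallel>z\<parallel>\<^sup>2\<close>, one of the two projections satisfies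
  \<open>\<parallel>P z\<parallel>\<^sup>2 \<le> (1 + c\<^sub>F) / 2 * \<parallel>z\<parallel>\<^sup>2\<close>, which improves one of the two summands of the convex
  combination, while the other is bounded by \<open>\<parallel>z\<parallel>\<close>. That \<open>c\<^sub>F < 1\<close> when \<open>U + V\<close> is closed is an
  open mapping argument: by Baire, every \<open>y \<in> U + V\<close> can be written as \<open>u + v\<close> with \<open>\<parallel>u\<parallel> \<le> C \<parallel>y\<parallel>\<close>.
\<close>

section \<open>Metric projection onto closed convex sets and subspaces\<close>

text \<open>A minimising sequence is Cauchy: midpoints stay in \<open>C\<close> by convexity, so
  they are no closer to \<open>x\<close> than \<open>d\<close>, and the parallelogram identity turns
  this into a bound on mutual distances. Completeness and closedness then give the
  minimiser.\<close>

lemma closest_point_exists: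
  fixes C :: "'a::{real_inner,complete_space} set"
  assumes "closed C" "convex C" "C \<noteq> {}"
  shows "\<exists>p\<in>C. \<forall>y\<in>C. dist x p \<le> dist x y"
proof -
  define d where "d = infdist x C"
  have d: "d \<le> dist x y" if "y \<in> C" for y
    unfolding d_def using that by (rule infdist_le)
  have d0: "0 \<le> d"
    unfolding d_def by (rule infdist_nonneg)
  \<comment> \<open>The slack sits on the squared distance to match the quadratic identity used in
    \<open>par\<close>.\<close>
  have "\<exists>y\<in>C. (dist x y)\<^sup>2 < d\<^sup>2 + inverse (real (Suc n))" for n
  proof -
    have "sqrt (d\<^sup>2) < sqrt (d\<^sup>2 + inverse (real (Suc n)))"
      by (rule real_sqrt_less_mono) simp
    then have "infdist x C < sqrt (d\<^sup>2 + inverse (real (Suc n)))"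
      using d0 by (simp add: d_def)
    then obtain y where y: "y \<in> C" "dist x y < sqrt (d\<^sup>2 + inverse (real (Suc n)))"
      using assms(3) by (auto simp: infdist_notempty cINF_less_iff)
    then have "(dist x y)\<^sup>2 < (sqrt (d\<^sup>2 + inverse (real (Suc n))))\<^sup>2"
      by (intro power_strict_mono) auto
    then show ?thesis
      using y(1) by (auto simp: add_nonneg_nonneg)
  qed
  then obtain p where pC: "p n \<in> C" and p: "(dist x (p n))\<^sup>2 < d\<^sup>2 + inverse (real (Suc n))" for n
    by metis
  have par: "(dist (p m) (p n))\<^sup>2 < 2 * inverse (real (Suc m)) + 2 * inverse (real (Suc n))" for m n
  proof -
    have "(1/2) *\<^sub>R p m + (1/2) *\<^sub>R p n \<in> C"
      using assms(2) pC by (auto intro!: convexD)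
    then have "d\<^sup>2 \<le> (dist x ((1/2) *\<^sub>R p m + (1/2) *\<^sub>R p n))\<^sup>2"
      using d d0 by (intro power_mono) auto
    \<comment> \<open>Parallelogram identity for \<open>x - p m\<close> and
      \<open>x - p n\<close>.\<close>
    moreover have "(dist (p m) (p n))\<^sup>2 = 2 * (dist x (p m))\<^sup>2 + 2 * (dist x (p n))\<^sup>2
        - 4 * (dist x ((1/2) *\<^sub>R p m + (1/2) *\<^sub>R p n))\<^sup>2"
      unfolding dist_norm power2_norm_eq_inner
      by (simp add: inner_simps inner_commute algebra_simps)
    ultimately show ?thesis
      using p[of m] p[of n] by linarith
  qed
  have "Cauchy p"
  proof (rule metric_CauchyI)
    fix e :: real assume "0 < e"
    then have "0 < e\<^sup>2 / 4" by simp
    then obtain N where N: "inverse (real (Suc N)) < e\<^sup>2 / 4"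
      using reals_Archimedean by blast
    have "dist (p m) (p n) < e" if "m \<ge> N" "n \<ge> N" for m n
    proof -
      have "inverse (real (Suc m)) \<le> inverse (real (Suc N))" "inverse (real (Suc n)) \<le> inverse (real (Suc N))"
        using that by (auto intro!: le_imp_inverse_le)
      then have "(dist (p m) (p n))\<^sup>2 < e\<^sup>2"
        using par[of m n] N by linarith
      then show ?thesis
        using \<open>0 < e\<close> by (simp add: power2_less_imp_less)
    qed
    then show "\<exists>M. \<forall>m\<ge>M. \<forall>n\<ge>M. dist (p m) (p n) < e" by blast
  qed
  then obtain q where q: "p \<longlonglongrightarrow> q"
    using Cauchy_convergent convergent_def by blast
  have "q \<in> C"
    using closed_sequentially[OF assms(1)] pC q by blast
  moreover have "(dist x q)\<^sup>2 \<le> d\<^sup>2"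
  proof (rule LIMSEQ_le)
    show "(\<lambda>n. (dist x (p n))\<^sup>2) \<longlonglongrightarrow> (dist x q)\<^sup>2"
      by (intro tendsto_intros q)
    show "(\<lambda>n. d\<^sup>2 + inverse (real (Suc n))) \<longlonglongrightarrow> d\<^sup>2"
      by (rule LIMSEQ_inverse_real_of_nat_add)
    show "\<exists>N. \<forall>n\<ge>N. (dist x (p n))\<^sup>2 \<le> d\<^sup>2 + inverse (real (Suc n))"
      using p less_imp_le by blast
  qed
  then have "dist x q \<le> d"
    using d0 by (rule power2_le_imp_le)
  ultimately show ?thesis
    using d order_trans by blast
qed

lemma
  fixes C :: "'a::{real_inner,complete_space} set"
  assumes "closed C" "convex C" "C \<noteq> {}"
  shows metric_proj_in: "metric_proj C x \<in> C"
    and metric_proj_le: "y \<in> C \<Longrightarrow> dist x (metric_proj C x) \<le> dist x y"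
proof -
  have "metric_proj C x \<in> C \<and> (\<forall>y\<in>C. dist x (metric_proj C x) \<le> dist x y)"
    unfolding metric_proj_def
    by (rule someI_ex) (use closest_point_exists[OF assms] in blast)
  then show "metric_proj C x \<in> C" "y \<in> C \<Longrightarrow> dist x (metric_proj C x) \<le> dist x y" by auto
qed

lemma metric_proj_orthogonal:
  fixes S :: "'a::{real_inner,complete_space} set"
  assumes "closed S" "subspace S" "s \<in> S"
  shows "(x - metric_proj S x) \<bullet> s = 0"
proof (cases "s = 0")
  case False
  have S: "convex S" "S \<noteq> {}"
    using assms(2) subspace_imp_convex subspace_0 by auto
  \<comment> \<open>This \<open>t\<close> minimises the norm of
    \<open>(x - p) - t *\<^sub>R s\<close>. Compared with \<open>t = 0\<close> the square drops by
    \<open>((x - p) \<bullet> s)\<^sup>2 / (s \<bullet> s)\<close>, which minimality of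
    \<open>p\<close> forces to be zero.\<close>
  define p t where "p = metric_proj S x" and "t = ((x - p) \<bullet> s) / (s \<bullet> s)"
  have "p + t *\<^sub>R s \<in> S"
    unfolding p_def using metric_proj_in[OF assms(1) S] assms subspace_add subspace_scale by blast
  then have "dist x p \<le> dist x (p + t *\<^sub>R s)"
    unfolding p_def by (rule metric_proj_le[OF assms(1) S])
  then have "(norm (x - p))\<^sup>2 \<le> (norm ((x - p) - t *\<^sub>R s))\<^sup>2"
    by (simp add: dist_norm algebra_simps)
  also have "\<dots> = (norm (x - p))\<^sup>2 - 2 * (t * ((x - p) \<bullet> s)) + t * (t * (s \<bullet> s))"
    unfolding power2_norm_eq_inner inner_diff_left inner_diff_right inner_scaleR_left inner_scaleR_right
    by (simp add: inner_commute algebra_simps)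
  also have "t * (s \<bullet> s) = (x - p) \<bullet> s"
    using False by (simp add: t_def)
  finally have "t * ((x - p) \<bullet> s) \<le> 0" by linarith
  then have "((x - p) \<bullet> s)\<^sup>2 / (s \<bullet> s) \<le> 0"
    by (simp add: t_def power2_eq_square)
  moreover have "s \<bullet> s > 0" using False by simp
  ultimately have "((x - p) \<bullet> s)\<^sup>2 \<le> 0"
    by (simp add: divide_le_0_iff not_less)
  then show ?thesis by (simp add: p_def)
qed simp

text \<open>The residuals at \<open>p\<close> and at the projection are both orthogonal to the
  difference of these two points, which lies in \<open>S\<close>; subtracting makes that difference
  orthogonal to itself.\<close>

lemma metric_proj_unique:
  fixes S :: "'a::{real_inner,complete_space} set"
  assumes "closed S" "subspace S" "p \<in> S" "\<And>s. s \<in> S \<Longrightarrow> (x - p) \<bullet> s = 0"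
  shows "metric_proj S x = p"
proof -
  define q where "q = metric_proj S x"
  have "q \<in> S"
    unfolding q_def using metric_proj_in assms(1,2) subspace_imp_convex subspace_0 by blast
  then have "q - p \<in> S"
    using assms(2,3) subspace_diff by blast
  then have "(x - q) \<bullet> (q - p) = 0" "(x - p) \<bullet> (q - p) = 0"
    unfolding q_def using metric_proj_orthogonal[OF assms(1,2)] assms(4) by blast+
  then have "(q - p) \<bullet> (q - p) = 0"
    by (simp add: inner_simps)
  then show ?thesis by (simp add: q_def)
qed

section \<open>Norm-controlled decompositions in a closed sum of subspaces\<close>

text \<open>The library's \<open>summable_norm_cancel\<close> is stated for the class \<^class>\<open>banach\<close>, which is not
  derivable from \<^class>\<open>real_inner\<close> and \<^class>\<open>complete_space\<close> by the type system.\<close>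

lemma abs_summable_imp_summable:
  fixes f :: "nat \<Rightarrow> 'a::{real_normed_vector,complete_space}"
  assumes "summable (\<lambda>n. norm (f n))"
  shows "summable f"
proof -
  have *: "norm ((\<Sum>i<m. f i) - (\<Sum>i<n. f i)) \<le> dist (\<Sum>i<m. norm (f i)) (\<Sum>i<n. norm (f i))"
    if "n \<le> m" for m n
  proof -
    have "(\<Sum>i<m. f i) - (\<Sum>i<n. f i) = (\<Sum>i\<in>{n..<m}. f i)"
      "(\<Sum>i<m. norm (f i)) - (\<Sum>i<n. norm (f i)) = (\<Sum>i\<in>{n..<m}. norm (f i))"
      using that by (simp_all add: sum_diff_nat_ivl lessThan_atLeast0)
    then show ?thesis
      using norm_sum[of f "{n..<m}"] by (simp add: dist_norm order_trans[OF _ abs_ge_self])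
  qed
  have "Cauchy (\<lambda>n. \<Sum>i<n. norm (f i))"
    using assms by (simp add: summable_iff_convergent convergent_Cauchy)
  then have "Cauchy (\<lambda>n. \<Sum>i<n. f i)"
    \<comment> \<open>The form of the Cauchy property that compares later terms with one fixed term
      suits \<open>*\<close>, which covers ordered indices only.\<close>
    unfolding Cauchy_altdef2 Cauchy_def
    by (metis (no_types, lifting) "*" Cauchy_altdef2 dist_norm dual_order.strict_trans2 order_refl)
  then show ?thesis
    by (simp add: summable_iff_convergent Cauchy_convergent)
qed

text \<open>By Baire, the closure of some \<open>A n\<close> contains a relative ball of the closed
  sum. Subtracting approximations at two points of that ball moves its centre to the origin, and
  scaling then reaches every \<open>y\<close>.\<close>

lemma closed_sum_approx_decomposition:
  fixes U V :: "'a::{real_normed_vector,complete_space} set"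
  assumes "subspace U" "subspace V" "closed {u + v | u v. u \<in> U \<and> v \<in> V}"
  shows "\<exists>C\<ge>0. \<forall>y\<in>{u + v | u v. u \<in> U \<and> v \<in> V}.
    \<exists>u\<in>U. \<exists>v\<in>V. norm u \<le> C * norm y \<and> norm (y - (u + v)) \<le> norm y / 2"
proof -
  define Y where "Y = {u + v | u v. u \<in> U \<and> v \<in> V}"
  define A where "A n = {u + v | u v. u \<in> U \<and> v \<in> V \<and> norm u \<le> real n}" for n
  have A: "closure (A n) \<subseteq> Y" for n
    by (rule closure_minimal) (use assms(3) in \<open>auto simp: A_def Y_def\<close>)
  have Y: "subspace Y"
    using subspace_sums[OF assms(1,2)] by (simp add: Y_def)
  have "(\<Union>n. closure (A n)) = Y"
  proof
    show "Y \<subseteq> (\<Union>n. closure (A n))"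
    proof
      fix y assume "y \<in> Y"
      then obtain u v where "y = u + v" "u \<in> U" "v \<in> V" by (auto simp: Y_def)
      moreover obtain n where "norm u \<le> real n" using real_arch_simple by blast
      ultimately have "y \<in> A n" by (auto simp: A_def)
      then show "y \<in> (\<Union>n. closure (A n))" using closure_subset by blast
    qed
  qed (use A in blast)
  moreover have "top_of_set Y interior_of Y \<noteq> {}"
    using subspace_0[OF Y] interior_of_topspace[of "top_of_set Y"] by auto
  moreover have "completely_metrizable_space (top_of_set Y)"
    using assms(3) closed_closedin completely_metrizable_space_closedin
      completely_metrizable_space_euclidean by (metis Y_def)
  \<comment> \<open>If every closure had empty interior relative to \<open>Y\<close>, so would their
    union \<open>Y\<close>, which is open in itself and contains \<open>0\<close>.\<close>
  ultimately obtain n where n: "top_of_set Y interior_of closure (A n) \<noteq> {}"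
    using Baire_category_alt[of "top_of_set Y" "range (\<lambda>n. closure (A n))"] A
    by (force simp: closed_subset)
  then obtain y0 T where T: "openin (top_of_set Y) T" "y0 \<in> T" "T \<subseteq> closure (A n)"
    by (auto simp: interior_of_def)
  then obtain e where e: "e > 0" "ball y0 e \<inter> Y \<subseteq> closure (A n)"
    by (metis openin_contains_ball order_trans)
  have y0: "y0 \<in> Y" using T A by blast
  \<comment> \<open>Two errors of size \<open>e / 8\<close> add up to \<open>e / 4\<close>, which
    the later factor \<open>1 / t\<close> turns into \<open>norm y / 2\<close>.\<close>
  have close: "\<exists>u\<in>U. \<exists>v\<in>V. norm u \<le> real n \<and> norm (y - (u + v)) < e / 8"
    if "y \<in> Y" "dist y0 y < e" for y
  proof -
    have "y \<in> closure (A n)" using that e by auto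
    then obtain a where "a \<in> A n" "dist a y < e / 8"
      using closure_approachable[of y "A n"] \<open>e > 0\<close> by (meson divide_pos_pos zero_less_numeral)
    then show ?thesis unfolding A_def dist_norm by (auto simp: norm_minus_commute) blast
  qed
  show ?thesis
  proof (intro exI conjI ballI)
    show "0 \<le> 4 * real n / e" using e by simp
    fix y assume "y \<in> {u + v | u v. u \<in> U \<and> v \<in> V}"
    then have yY: "y \<in> Y" by (simp add: Y_def)
    show "\<exists>u\<in>U. \<exists>v\<in>V. norm u \<le> 4 * real n / e * norm y \<and> norm (y - (u + v)) \<le> norm y / 2"
    proof (cases "y = 0")
      case True
      then show ?thesis
        using subspace_0[OF assms(1)] subspace_0[OF assms(2)] by force
    next
      case False
      \<comment> \<open>Scales \<open>y\<close> to length \<open>e / 2\<close>, so that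
        \<open>y0 + t *\<^sub>R y\<close> stays in the ball.\<close>
      define t where "t = e / (2 * norm y)"
      have t: "t > 0" using e False by (simp add: t_def)
      have "y0 + t *\<^sub>R y \<in> Y" using Y y0 yY subspace_add subspace_scale by blast
      moreover have "dist y0 (y0 + t *\<^sub>R y) < e"
        using e False by (simp add: dist_norm t_def)
      ultimately obtain u1 v1 where 1: "u1 \<in> U" "v1 \<in> V" "norm u1 \<le> real n"
        "norm (y0 + t *\<^sub>R y - (u1 + v1)) < e / 8" using close by blast
      obtain u0 v0 where 0: "u0 \<in> U" "v0 \<in> V" "norm u0 \<le> real n"
        "norm (y0 - (u0 + v0)) < e / 8" using close[OF y0] e by auto
      \<comment> \<open>Subtracting the approximation at \<open>y0\<close> cancels the centre;
        division by \<open>t\<close> undoes the scaling.\<close>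
      define u v where "u = (1 / t) *\<^sub>R (u1 - u0)" and "v = (1 / t) *\<^sub>R (v1 - v0)"
      have uv: "u \<in> U" "v \<in> V"
        using 0 1 assms(1,2) by (auto simp: u_def v_def subspace_scale subspace_diff)
      have "norm (u1 - u0) \<le> 2 * real n"
        using 0 1 norm_triangle_ineq4[of u1 u0] by linarith
      then have "norm u \<le> (1 / t) * (2 * real n)"
        unfolding u_def norm_scaleR using t by (intro mult_mono) auto
      then have u: "norm u \<le> 4 * real n / e * norm y"
        by (simp add: t_def algebra_simps)
      have "y - (u + v) = (1 / t) *\<^sub>R ((y0 + t *\<^sub>R y - (u1 + v1)) - (y0 - (u0 + v0)))"
        using t by (simp add: u_def v_def algebra_simps)
      then have "norm (y - (u + v)) = (1 / t) * norm ((y0 + t *\<^sub>R y - (u1 + v1)) - (y0 - (u0 + v0)))"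
        using t by (metis abs_of_pos norm_scaleR zero_less_divide_1_iff)
      also have "\<dots> \<le> (1 / t) * (e / 4)"
        using t 0(4) 1(4) norm_triangle_ineq4[of "y0 + t *\<^sub>R y - (u1 + v1)" "y0 - (u0 + v0)"]
        by (intro mult_left_mono) auto
      also have "\<dots> = norm y / 2"
        using e by (simp add: t_def)
      finally show ?thesis using uv u by blast
    qed
  qed
qed

text \<open>The approximate decomposition is applied repeatedly to the remainder, and the resulting
  corrections are summed.\<close>

lemma closed_sum_decomposition:
  fixes U V :: "'a::{real_normed_vector,complete_space} set"
  assumes "subspace U" "subspace V" "closed U" "closed V"
    and "closed {u + v | u v. u \<in> U \<and> v \<in> V}"
  shows "\<exists>C\<ge>0. \<forall>y\<in>{u + v | u v. u \<in> U \<and> v \<in> V}.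
    \<exists>u\<in>U. \<exists>v\<in>V. norm u \<le> C * norm y \<and> y = u + v"
proof -
  define Y where "Y = {u + v | u v. u \<in> U \<and> v \<in> V}"
  have Y: "subspace Y"
    using subspace_sums[OF assms(1,2)] by (simp add: Y_def)
  obtain C where C: "C \<ge> 0" "\<And>y. y \<in> Y \<Longrightarrow>
    \<exists>u\<in>U. \<exists>v\<in>V. norm u \<le> C * norm y \<and> norm (y - (u + v)) \<le> norm y / 2"
    using closed_sum_approx_decomposition[OF assms(1,2,5)] unfolding Y_def by blast
  then have "\<forall>y. \<exists>u v. y \<in> Y \<longrightarrow> u \<in> U \<and> v \<in> V \<and> norm u \<le> C * norm y \<and> norm (y - (u + v)) \<le> norm y / 2"
    by blast
  then obtain f g where fg: "f y \<in> U" "g y \<in> V" "norm (f y) \<le> C * norm y"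
    "norm (y - (f y + g y)) \<le> norm y / 2" if "y \<in> Y" for y
    by metis
  define r where "r y = y - (f y + g y)" for y
  have r: "r y = y - (f y + g y)" for y
    by (simp add: r_def)
  show ?thesis
  proof (intro exI conjI ballI)
    \<comment> \<open>The factor 2 is the sum of the geometric series of ratio 1/2 that dominates
      the norms of the corrections \<open>h n\<close>.\<close>
    show "0 \<le> 2 * C" using C by simp
    fix y assume "y \<in> {u + v | u v. u \<in> U \<and> v \<in> V}"
    then have y: "y \<in> Y" by (simp add: Y_def)
    have rY: "(r ^^ n) y \<in> Y" for n
    proof (induction n)
      case (Suc n)
      moreover have "f ((r ^^ n) y) + g ((r ^^ n) y) \<in> Y"
        using fg(1,2)[OF Suc] unfolding Y_def by blast
      ultimately show ?case using subspace_diff[OF Y] by (simp add: r[of "(r ^^ n) y"])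
    qed (simp add: y)
    have rn: "norm ((r ^^ n) y) \<le> norm y * (1 / 2) ^ n" for n
    proof (induction n)
      case (Suc n)
      then show ?case using fg(4)[OF rY[of n]] by (simp add: r[of "(r ^^ n) y"])
    qed simp
    define h where "h n = f ((r ^^ n) y)" for n
    have hn: "norm (h n) \<le> C * norm y * (1 / 2) ^ n" for n
      using fg(3)[OF rY[of n]] mult_left_mono[OF rn[of n] C(1)] by (simp add: h_def mult.assoc)
    have geo: "(\<lambda>n. C * norm y * (1 / 2) ^ n) sums (C * norm y * 2)"
      using sums_mult[OF geometric_sums[of "1/2::real"]] by force
    have sn: "summable (\<lambda>n. norm (h n))"
      by (rule summable_comparison_test'[OF sums_summable[OF geo], of 0]) (use hn in auto)
    then obtain u where u: "h sums u"
      using abs_summable_imp_summable by blast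
    \<comment> \<open>Telescoping: each round removes an \<open>f\<close> part and a
      \<open>g\<close> part from the current remainder.\<close>
    have rem: "y - (\<Sum>i<n. h i) = (\<Sum>i<n. g ((r ^^ i) y)) + (r ^^ n) y" for n
      by (induction n) (simp_all add: r[of "(r ^^ _) y"] h_def algebra_simps)
    have r0: "(\<lambda>n. (r ^^ n) y) \<longlonglongrightarrow> 0"
    proof (rule Lim_null_comparison)
      show "\<forall>\<^sub>F n in sequentially. norm ((r ^^ n) y) \<le> norm y * (1 / 2) ^ n"
        using rn by simp
      show "(\<lambda>n. norm y * (1 / 2) ^ n) \<longlonglongrightarrow> 0"
        by (intro tendsto_mult_right_zero LIMSEQ_realpow_zero) auto
    qed
    have uU: "u \<in> U"
    proof (rule closed_sequentially[OF assms(3)])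
      show "(\<lambda>n. \<Sum>i<n. h i) \<longlonglongrightarrow> u" using u by (simp add: sums_def)
      show "(\<Sum>i<n. h i) \<in> U" for n
        using fg(1)[OF rY] assms(1) by (auto simp: h_def intro: subspace_sum)
    qed
    \<comment> \<open>The \<open>g\<close> parts carry no norm bound of their own; convergence of
      their partial sums is read off from \<open>rem\<close>.\<close>
    have vV: "y - u \<in> V"
    proof (rule closed_sequentially[OF assms(4)])
      have "(\<lambda>n. y - (\<Sum>i<n. h i) - (r ^^ n) y) \<longlonglongrightarrow> y - u - 0"
        using u r0 by (intro tendsto_intros) (auto simp: sums_def)
      then show "(\<lambda>n. \<Sum>i<n. g ((r ^^ i) y)) \<longlonglongrightarrow> y - u"
        by (simp add: rem)
      show "(\<Sum>i<n. g ((r ^^ i) y)) \<in> V" for n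
        using fg(2)[OF rY] assms(2) by (auto intro: subspace_sum)
    qed
    have "norm u \<le> 2 * C * norm y"
    proof (rule LIMSEQ_le_const2)
      show "(\<lambda>n. norm (\<Sum>i<n. h i)) \<longlonglongrightarrow> norm u"
        using u by (intro tendsto_norm) (simp add: sums_def)
      have "norm (\<Sum>i<n. h i) \<le> 2 * C * norm y" for n
      proof -
        have "norm (\<Sum>i<n. h i) \<le> (\<Sum>i<n. C * norm y * (1 / 2) ^ i)"
          by (intro sum_norm_le hn)
        also have "\<dots> \<le> C * norm y * 2"
          using sum_le_suminf[OF sums_summable[OF geo], of "{..<n}"] sums_unique[OF geo] C(1) by simp
        finally show ?thesis by simp
      qed
      then show "\<exists>N. \<forall>n\<ge>N. norm (\<Sum>i<n. h i) \<le> 2 * C * norm y" by blast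
    qed
    then show "\<exists>u\<in>U. \<exists>v\<in>V. norm u \<le> 2 * C * norm y \<and> y = u + v"
      using uU vV by (intro bexI[of _ u] bexI[of _ "y - u"]) auto
  qed
qed

section \<open>The cosine of the Friedrichs angle\<close>

lemma friedrichs_cos_bdd_above:
  fixes U V :: "'a::real_inner set"
  shows "bdd_above {\<bar>u \<bullet> v\<bar> | u v. u \<in> U \<inter> (U \<inter> V)\<^sup>\<bottom> \<and> v \<in> V \<inter> (U \<inter> V)\<^sup>\<bottom> \<and> norm u \<le> 1 \<and> norm v \<le> 1}"
proof (rule bdd_aboveI)
  fix x assume "x \<in> {\<bar>u \<bullet> v\<bar> | u v. u \<in> U \<inter> (U \<inter> V)\<^sup>\<bottom> \<and> v \<in> V \<inter> (U \<inter> V)\<^sup>\<bottom> \<and> norm u \<le> 1 \<and> norm v \<le> 1}"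
  then obtain u v :: 'a where "x = \<bar>u \<bullet> v\<bar>" "norm u \<le> 1" "norm v \<le> 1" by blast
  then show "x \<le> 1"
    using Cauchy_Schwarz_ineq2[of u v] mult_le_one[of "norm u" "norm v"] by simp
qed

lemma friedrichs_cos_nonneg:
  assumes "subspace U" "subspace V"
  shows "0 \<le> friedrichs_cos U V"
  unfolding friedrichs_cos_def
proof (rule cSup_upper[OF _ friedrichs_cos_bdd_above])
  have "0 \<in> U \<inter> (U \<inter> V)\<^sup>\<bottom>" "0 \<in> V \<inter> (U \<inter> V)\<^sup>\<bottom>"
    using assms by (auto simp: subspace_0 subspace_orthogonal_comp)
  then show "0 \<in> {\<bar>u \<bullet> v\<bar> | u v. u \<in> U \<inter> (U \<inter> V)\<^sup>\<bottom> \<and> v \<in> V \<inter> (U \<inter> V)\<^sup>\<bottom> \<and> norm u \<le> 1 \<and> norm v \<le> 1}"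
    by force
qed

text \<open>Homogeneous form of the supremum bound, obtained by normalising both vectors.\<close>

lemma inner_le_friedrichs_cos:
  assumes "subspace U" "subspace V"
    and u: "u \<in> U \<inter> (U \<inter> V)\<^sup>\<bottom>" and v: "v \<in> V \<inter> (U \<inter> V)\<^sup>\<bottom>"
  shows "\<bar>u \<bullet> v\<bar> \<le> friedrichs_cos U V * (norm u * norm v)"
proof (cases "u = 0 \<or> v = 0")
  case False
  have sub: "subspace (U \<inter> (U \<inter> V)\<^sup>\<bottom>)" "subspace (V \<inter> (U \<inter> V)\<^sup>\<bottom>)"
    using assms(1,2) by (auto intro: subspace_inter subspace_orthogonal_comp)
  have "\<bar>(u /\<^sub>R norm u) \<bullet> (v /\<^sub>R norm v)\<bar> \<le> friedrichs_cos U V"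
    unfolding friedrichs_cos_def
  proof (rule cSup_upper[OF _ friedrichs_cos_bdd_above], rule CollectI, intro exI conjI)
    show "u /\<^sub>R norm u \<in> U \<inter> (U \<inter> V)\<^sup>\<bottom>" "v /\<^sub>R norm v \<in> V \<inter> (U \<inter> V)\<^sup>\<bottom>"
      using sub u v subspace_scale by blast+
  qed (use False in auto)
  then have "\<bar>u \<bullet> v\<bar> / (norm u * norm v) \<le> friedrichs_cos U V"
    by (simp add: abs_mult divide_simps mult.commute)
  then show ?thesis
    using False by (simp add: pos_divide_le_eq)
qed auto

text \<open>For \<open>u\<close> orthogonal to the intersection, the \<open>U\<close> part
  \<open>u\<close> of \<open>u + v\<close> has least norm among all decompositions. The controlled
  decomposition therefore bounds \<open>norm u\<close> by \<open>norm (u - v)\<close>, which keeps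
  \<open>u \<bullet> v\<close> uniformly away from 1 on the unit balls.\<close>

lemma friedrichs_cos_less_1:
  fixes U V :: "'a::{real_inner,complete_space} set"
  assumes "subspace U" "subspace V" "closed U" "closed V"
    and "closed {u + v | u v. u \<in> U \<and> v \<in> V}"
  shows "friedrichs_cos U V < 1"
proof -
  obtain C where C: "C \<ge> 0" "\<And>y. y \<in> {u + v | u v. u \<in> U \<and> v \<in> V} \<Longrightarrow>
    \<exists>u\<in>U. \<exists>v\<in>V. norm u \<le> C * norm y \<and> y = u + v"
    using closed_sum_decomposition[OF assms] by blast
  have low: "norm u \<le> C * norm (u + v)"
    if u: "u \<in> U" "u \<in> (U \<inter> V)\<^sup>\<bottom>" and v: "v \<in> V" for u v
  proof -
    obtain u' v' where 1: "u' \<in> U" "v' \<in> V" "norm u' \<le> C * norm (u + v)" "u + v = u' + v'"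
      using C(2)[of "u + v"] u v by blast
    \<comment> \<open>The two decompositions differ by a vector of the intersection, to which
      \<open>u\<close> is orthogonal.\<close>
    have "u - u' \<in> U" "v' - v \<in> V"
      using u v 1 assms(1,2) by (auto simp: subspace_diff)
    moreover have "v' - v = u - u'"
      using 1(4) by (simp add: algebra_simps)
    ultimately have "(u - u') \<bullet> u = 0"
      using u(2) by (auto simp: orthogonal_comp_def orthogonal_def)
    then have "(norm u')\<^sup>2 = (norm u)\<^sup>2 + (norm (u - u'))\<^sup>2"
      unfolding power2_norm_eq_inner by (simp add: inner_simps inner_commute)
    then have "(norm u)\<^sup>2 \<le> (norm u')\<^sup>2" by simp
    then have "norm u \<le> norm u'"
      by (rule power2_le_imp_le) simp
    then show ?thesis using 1 by simp
  qed
  define K where "K = C + 1"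
  have K: "K \<ge> 1" "C \<le> K" using C by (auto simp: K_def)
  \<comment> \<open>Here \<open>2 * \<delta>\<close> is the constant \<open>1 / K\<^sup>2\<close> of
    the squared bound, and \<open>K \<ge> 1\<close> keeps the coefficient
    \<open>1 - 2 * \<delta>\<close> nonnegative.\<close>
  define \<delta> where "\<delta> = 1 / (2 * K\<^sup>2)"
  have \<delta>: "0 < \<delta>" "\<delta> \<le> 1 / 2"
    using K one_le_power[of K 2] by (auto simp: \<delta>_def field_simps)
  have bound: "u \<bullet> v \<le> 1 - \<delta>"
    if u: "u \<in> U" "u \<in> (U \<inter> V)\<^sup>\<bottom>" and v: "v \<in> V" and n: "norm u \<le> 1" "norm v \<le> 1" for u v
  proof -
    have "norm u \<le> C * norm (u - v)"
      using low[of u "- v"] u v assms(2) subspace_neg by auto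
    also have "\<dots> \<le> K * norm (u - v)"
      using K by (intro mult_right_mono) auto
    finally have "(norm u)\<^sup>2 \<le> (K * norm (u - v))\<^sup>2"
      by (intro power_mono) auto
    then have "2 * \<delta> * (norm u)\<^sup>2 \<le> (norm (u - v))\<^sup>2"
      using K by (simp add: \<delta>_def power_mult_distrib divide_le_eq mult.commute)
    also have "\<dots> = (norm u)\<^sup>2 + (norm v)\<^sup>2 - 2 * (u \<bullet> v)"
      unfolding power2_norm_eq_inner by (simp add: inner_simps inner_commute)
    finally have "2 * (u \<bullet> v) \<le> (1 - 2 * \<delta>) * (norm u)\<^sup>2 + (norm v)\<^sup>2"
      by (simp add: algebra_simps)
    also have "\<dots> \<le> (1 - 2 * \<delta>) * 1 + 1"
      using n \<delta> by (intro add_mono mult_left_mono) (auto simp: power_le_one)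
    finally show ?thesis by simp
  qed
  have "friedrichs_cos U V \<le> 1 - \<delta>"
    unfolding friedrichs_cos_def
  proof (rule cSup_least)
    have "0 \<in> U \<inter> (U \<inter> V)\<^sup>\<bottom>" "0 \<in> V \<inter> (U \<inter> V)\<^sup>\<bottom>"
      using assms by (auto simp: subspace_0 subspace_orthogonal_comp)
    then show "{\<bar>u \<bullet> v\<bar> | u v. u \<in> U \<inter> (U \<inter> V)\<^sup>\<bottom> \<and> v \<in> V \<inter> (U \<inter> V)\<^sup>\<bottom> \<and> norm u \<le> 1 \<and> norm v \<le> 1} \<noteq> {}"
      by force
    fix x assume "x \<in> {\<bar>u \<bullet> v\<bar> | u v. u \<in> U \<inter> (U \<inter> V)\<^sup>\<bottom> \<and> v \<in> V \<inter> (U \<inter> V)\<^sup>\<bottom> \<and> norm u \<le> 1 \<and> norm v \<le> 1}"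
    then obtain u v where x: "x = \<bar>u \<bullet> v\<bar>" and uv: "u \<in> U" "u \<in> (U \<inter> V)\<^sup>\<bottom>" "v \<in> V" "norm u \<le> 1" "norm v \<le> 1"
      by blast
    then have "u \<bullet> (- v) \<le> 1 - \<delta>" "u \<bullet> v \<le> 1 - \<delta>"
      using bound[of u v] bound[of u "- v"] assms(2) subspace_neg by auto
    then show "x \<le> 1 - \<delta>" using x by simp
  qed
  then show ?thesis using \<delta> by simp
qed

text \<open>Orthogonality gives \<open>S = z \<bullet> (u + v)\<close>, while the angle bound gives
  \<open>(norm (u + v))\<^sup>2 \<le> (1 + c) * S\<close>. Cauchy-Schwarz combines them, and one
  factor \<open>S\<close> cancels.\<close>

lemma projections_norm_le_friedrichs:
  fixes U V :: "'a::{real_inner,complete_space} set"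
  assumes "subspace U" "subspace V"
    and u: "u \<in> U" "\<And>s. s \<in> U \<Longrightarrow> (z - u) \<bullet> s = 0"
    and v: "v \<in> V" "\<And>s. s \<in> V \<Longrightarrow> (z - v) \<bullet> s = 0"
    and z: "\<And>s. s \<in> U \<inter> V \<Longrightarrow> z \<bullet> s = 0"
  shows "(norm u)\<^sup>2 + (norm v)\<^sup>2 \<le> (1 + friedrichs_cos U V) * (norm z)\<^sup>2"
proof -
  define c where "c = friedrichs_cos U V"
  define S where "S = (norm u)\<^sup>2 + (norm v)\<^sup>2"
  have c: "0 \<le> c" unfolding c_def by (rule friedrichs_cos_nonneg[OF assms(1,2)])
  \<comment> \<open>On the intersection, \<open>u\<close> and \<open>v\<close> have the same inner
    products as \<open>z\<close>, namely zero.\<close>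
  have "u \<bullet> s = 0" "v \<bullet> s = 0" if "s \<in> U \<inter> V" for s
    using that u(2)[of s] v(2)[of s] z[of s] by (auto simp: inner_diff_left)
  then have "u \<in> U \<inter> (U \<inter> V)\<^sup>\<bottom>" "v \<in> V \<inter> (U \<inter> V)\<^sup>\<bottom>"
    using u(1) v(1) by (auto simp: orthogonal_comp_def orthogonal_def inner_commute)
  then have "\<bar>u \<bullet> v\<bar> \<le> c * (norm u * norm v)"
    unfolding c_def by (rule inner_le_friedrichs_cos[OF assms(1,2)])
  moreover have "c * (2 * (norm u * norm v)) \<le> c * S"
    using c sum_squares_bound[of "norm u" "norm v"] by (intro mult_left_mono) (auto simp: S_def)
  ultimately have "2 * (u \<bullet> v) \<le> c * S" by linarith
  then have uv: "(norm (u + v))\<^sup>2 \<le> (1 + c) * S"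
    unfolding S_def power2_norm_eq_inner by (simp add: inner_simps inner_commute algebra_simps)
  have "S = z \<bullet> (u + v)"
    using u(2)[OF u(1)] v(2)[OF v(1)] unfolding S_def power2_norm_eq_inner
    by (simp add: inner_simps)
  also have "\<dots> \<le> norm z * norm (u + v)"
    by (rule norm_cauchy_schwarz)
  finally have "S\<^sup>2 \<le> (norm z * norm (u + v))\<^sup>2"
    by (intro power_mono) (auto simp: S_def)
  also have "\<dots> \<le> (norm z)\<^sup>2 * ((1 + c) * S)"
    unfolding power_mult_distrib by (intro mult_left_mono uv) auto
  finally have "S * S \<le> ((1 + c) * (norm z)\<^sup>2) * S"
    by (simp add: power2_eq_square ac_simps)
  moreover have "0 \<le> S" by (simp add: S_def)
  ultimately have "S \<le> (1 + c) * (norm z)\<^sup>2"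
    using c by (cases "S = 0") (auto simp: mult_le_cancel_right)
  then show ?thesis by (simp add: S_def c_def)
qed

section \<open>Geometry of a best approximation mapping with linear fixed point set\<close>

text \<open>\<open>G x\<close> and \<open>x\<close> share their projection, so this is the
  orthogonality of the residual of \<open>G x\<close>.\<close>

lemma BAM_orthogonal:
  assumes "is_BAM \<gamma> G" "subspace (Fix G)" "s \<in> Fix G"
  shows "(G x - metric_proj (Fix G) x) \<bullet> s = 0"
proof -
  have "metric_proj (Fix G) (G x) = metric_proj (Fix G) x" "closed (Fix G)"
    using assms(1) by (auto simp: is_BAM_def fun_eq_iff)
  then show ?thesis
    using metric_proj_orthogonal[OF _ assms(2,3), of "G x"] by simp
qed

text \<open>Both \<open>G x - p\<close> and \<open>x - p\<close> are orthogonal to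
  \<open>p - w\<close>; the two Pythagorean identities eliminate \<open>norm (x - p)\<close> from
  the contraction estimate.\<close>

lemma BAM_norm_le:
  assumes "is_BAM \<gamma> G" "subspace (Fix G)" "w \<in> Fix G"
  shows "(norm (G x - w))\<^sup>2 \<le> \<gamma>\<^sup>2 * (norm (x - w))\<^sup>2 + (1 - \<gamma>\<^sup>2) * (norm (metric_proj (Fix G) x - w))\<^sup>2"
proof -
  define p where "p = metric_proj (Fix G) x"
  have G: "closed (Fix G)" "norm (G x - p) \<le> \<gamma> * norm (x - p)"
    using assms(1) by (auto simp: is_BAM_def p_def)
  have "p \<in> Fix G"
    unfolding p_def using metric_proj_in[OF G(1)] assms(2) subspace_imp_convex subspace_0 by blast
  then have pw: "p - w \<in> Fix G"
    using assms subspace_diff by blast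
  have "(norm (G x - w))\<^sup>2 = (norm (G x - p))\<^sup>2 + (norm (p - w))\<^sup>2"
    using BAM_orthogonal[OF assms(1,2) pw, of x]
    unfolding p_def[symmetric] power2_norm_eq_inner by (simp add: inner_simps inner_commute)
  moreover have "(norm (x - w))\<^sup>2 = (norm (x - p))\<^sup>2 + (norm (p - w))\<^sup>2"
    using metric_proj_orthogonal[OF G(1) assms(2) pw, of x]
    unfolding p_def[symmetric] power2_norm_eq_inner by (simp add: inner_simps inner_commute)
  moreover have "(norm (G x - p))\<^sup>2 \<le> (\<gamma> * norm (x - p))\<^sup>2"
    using G(2) by (intro power_mono) auto
  ultimately show ?thesis
    by (simp add: p_def power_mult_distrib algebra_simps)
qed

section \<open>Convex combination of two best approximation mappings\<close>

theorem theorem5p4: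
  fixes G\<^sub>1 G\<^sub>2 :: "'h::{real_inner,complete_space} \<Rightarrow> 'h"
    and \<gamma>\<^sub>1 \<gamma>\<^sub>2 \<alpha> c\<^sub>F \<gamma> :: real
  assumes "\<gamma>\<^sub>1 \<in> {0..<1}" and "\<gamma>\<^sub>2 \<in> {0..<1}"
    and "is_BAM \<gamma>\<^sub>1 G\<^sub>1" and "is_BAM \<gamma>\<^sub>2 G\<^sub>2"
    and "closed (Fix G\<^sub>1)" and "subspace (Fix G\<^sub>1)"
    and "closed (Fix G\<^sub>2)" and "subspace (Fix G\<^sub>2)"
    and "closed {u + v | u v. u \<in> Fix G\<^sub>1 \<and> v \<in> Fix G\<^sub>2}"
    and "\<alpha> \<in> {0<..<1}"
    and "c\<^sub>F = friedrichs_cos (Fix G\<^sub>1) (Fix G\<^sub>2)"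
    and "\<gamma> = max (\<alpha> * sqrt (\<gamma>\<^sub>1\<^sup>2 + (1 - \<gamma>\<^sub>1\<^sup>2) * ((1 + c\<^sub>F) / 2)) + (1 - \<alpha>))
                 (\<alpha> + (1 - \<alpha>) * sqrt (\<gamma>\<^sub>2\<^sup>2 + (1 - \<gamma>\<^sub>2\<^sup>2) * ((1 + c\<^sub>F) / 2)))"
  shows "max (\<alpha> * sqrt (1 / 2 * (1 + \<gamma>\<^sub>1\<^sup>2)) + (1 - \<alpha>))
             (\<alpha> + (1 - \<alpha>) * sqrt (1 / 2 * (1 + \<gamma>\<^sub>2\<^sup>2))) \<le> \<gamma>
         \<and> \<gamma> < 1
         \<and> is_BAM \<gamma> (\<lambda>x. \<alpha> *\<^sub>R G\<^sub>1 x + (1 - \<alpha>) *\<^sub>R G\<^sub>2 x)"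
proof -
  let ?U = "Fix G\<^sub>1" and ?V = "Fix G\<^sub>2"
  \<comment> \<open>\<open>W\<close> stands in for \<open>Fix T\<close>; their equality comes only
    after the contraction estimate, from which it follows.\<close>
  define W where "W = ?U \<inter> ?V"
  define T where "T x = \<alpha> *\<^sub>R G\<^sub>1 x + (1 - \<alpha>) *\<^sub>R G\<^sub>2 x" for x
  define q where "q g = g\<^sup>2 + (1 - g\<^sup>2) * ((1 + c\<^sub>F) / 2)" for g :: real
  have \<alpha>: "0 < \<alpha>" "\<alpha> < 1" using assms(10) by auto
  have c: "0 \<le> c\<^sub>F" "c\<^sub>F < 1"
    using friedrichs_cos_nonneg friedrichs_cos_less_1 assms by auto
  have \<gamma>: "\<gamma> = max (\<alpha> * sqrt (q \<gamma>\<^sub>1) + (1 - \<alpha>)) (\<alpha> + (1 - \<alpha>) * sqrt (q \<gamma>\<^sub>2))"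
    unfolding q_def by (rule assms(12))
  have q: "sqrt (1 / 2 * (1 + g\<^sup>2)) \<le> sqrt (q g)" "sqrt (q g) < 1" if "g \<in> {0..<1}" for g
  proof -
    have g: "g\<^sup>2 < 1" using that by (simp add: power_less_one_iff)
    \<comment> \<open>Half of this quantity is the gap between the two radicands.\<close>
    then have "0 \<le> (1 - g\<^sup>2) * c\<^sub>F" using c by simp
    then show "sqrt (1 / 2 * (1 + g\<^sup>2)) \<le> sqrt (q g)"
      by (intro real_sqrt_le_mono) (simp add: q_def field_simps)
    \<comment> \<open>\<open>q g\<close> averages 1 and \<open>(1 + c\<^sub>F) / 2\<close>, with
      positive weight on the latter, which is below 1.\<close>
    have "(1 - g\<^sup>2) * ((1 + c\<^sub>F) / 2) < (1 - g\<^sup>2) * 1"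
      using g c by (intro mult_strict_left_mono) auto
    then show "sqrt (q g) < 1" by (simp add: q_def)
  qed
  have lower: "max (\<alpha> * sqrt (1 / 2 * (1 + \<gamma>\<^sub>1\<^sup>2)) + (1 - \<alpha>))
             (\<alpha> + (1 - \<alpha>) * sqrt (1 / 2 * (1 + \<gamma>\<^sub>2\<^sup>2))) \<le> \<gamma>"
    unfolding \<gamma> using \<alpha> q(1)[OF assms(1)] q(1)[OF assms(2)]
    by (intro max.mono add_mono mult_left_mono) auto
  have "\<alpha> * sqrt (q \<gamma>\<^sub>1) < \<alpha> * 1" "(1 - \<alpha>) * sqrt (q \<gamma>\<^sub>2) < (1 - \<alpha>) * 1"
    using \<alpha> q(2)[OF assms(1)] q(2)[OF assms(2)] by (auto intro!: mult_strict_left_mono)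
  then have upper: "\<gamma> < 1" unfolding \<gamma> by simp
  have "0 \<le> \<alpha> * sqrt (1 / 2 * (1 + \<gamma>\<^sub>1\<^sup>2)) + (1 - \<alpha>)" using \<alpha> by simp
  then have nonneg: "0 \<le> \<gamma>" using lower by linarith
  have W: "closed W" "subspace W"
    using assms(5-8) by (auto simp: W_def subspace_inter)
  have projW: "metric_proj W x \<in> W" for x
    using metric_proj_in[OF W(1)] W(2) subspace_imp_convex subspace_0 by blast
  have T_orth: "(T x - metric_proj W x) \<bullet> s = 0" if s: "s \<in> W" for x s
  proof -
    have "(G\<^sub>1 x - x) \<bullet> s = 0" "(G\<^sub>2 x - x) \<bullet> s = 0"
      using BAM_orthogonal[OF assms(3,6), of s x] metric_proj_orthogonal[OF assms(5,6), of s x]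
        BAM_orthogonal[OF assms(4,8), of s x] metric_proj_orthogonal[OF assms(7,8), of s x] s
      by (auto simp: W_def inner_diff_left)
    moreover have "T x - metric_proj W x = \<alpha> *\<^sub>R (G\<^sub>1 x - x) + (1 - \<alpha>) *\<^sub>R (G\<^sub>2 x - x) + (x - metric_proj W x)"
      by (simp add: T_def algebra_simps)
    ultimately show ?thesis
      using metric_proj_orthogonal[OF W s, of x]
      unfolding \<open>T x - metric_proj W x = _\<close> inner_add_left by simp
  qed
  have T_norm: "norm (T x - metric_proj W x) \<le> \<gamma> * norm (x - metric_proj W x)" for x
  proof -
    define w z where "w = metric_proj W x" and "z = x - w"
    \<comment> \<open>Since \<open>w\<close> lies in both subspaces, these are the projections of
      \<open>z\<close>.\<close>
    define u v where "u = metric_proj ?U x - w" and "v = metric_proj ?V x - w"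
    have w: "w \<in> ?U" "w \<in> ?V" using projW[of x] by (auto simp: w_def W_def)
    have "metric_proj ?U x \<in> ?U" "metric_proj ?V x \<in> ?V"
      using metric_proj_in assms(5-8) subspace_imp_convex subspace_0 by blast+
    then have uv: "u \<in> ?U" "v \<in> ?V"
      using w assms(6,8) by (auto simp: u_def v_def subspace_diff)
    have sum: "(norm u)\<^sup>2 + (norm v)\<^sup>2 \<le> (1 + c\<^sub>F) * (norm z)\<^sup>2"
      unfolding assms(11)
    proof (rule projections_norm_le_friedrichs[OF assms(6,8)])
      show "(z - u) \<bullet> s = 0" if "s \<in> ?U" for s
        using metric_proj_orthogonal[OF assms(5,6) that, of x] by (simp add: z_def u_def)
      show "(z - v) \<bullet> s = 0" if "s \<in> ?V" for s
        using metric_proj_orthogonal[OF assms(7,8) that, of x] by (simp add: z_def v_def)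
      show "z \<bullet> s = 0" if "s \<in> ?U \<inter> ?V" for s
        using metric_proj_orthogonal[OF W, of s x] that by (simp add: z_def w_def W_def)
    qed (use uv in auto)
    have improved: "norm y \<le> sqrt (q g) * norm z"
      if "(norm y)\<^sup>2 \<le> g\<^sup>2 * (norm z)\<^sup>2 + (1 - g\<^sup>2) * (norm a)\<^sup>2" "g \<in> {0..<1}"
        "(norm a)\<^sup>2 \<le> (1 + c\<^sub>F) / 2 * (norm z)\<^sup>2" for y a :: 'h and g
    proof (rule power2_le_imp_le)
      have g: "g\<^sup>2 \<le> 1" using that(2) by (simp add: power_le_one)
      have "0 \<le> q g" using g c by (simp add: q_def)
      have "(norm y)\<^sup>2 \<le> g\<^sup>2 * (norm z)\<^sup>2 + (1 - g\<^sup>2) * ((1 + c\<^sub>F) / 2 * (norm z)\<^sup>2)"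
        using that(1) mult_left_mono[OF that(3), of "1 - g\<^sup>2"] g by linarith
      also have "\<dots> = q g * (norm z)\<^sup>2"
        by (simp add: q_def algebra_simps)
      finally show "(norm y)\<^sup>2 \<le> (sqrt (q g) * norm z)\<^sup>2"
        using \<open>0 \<le> q g\<close> by (simp add: power_mult_distrib)
      show "0 \<le> sqrt (q g) * norm z" using \<open>0 \<le> q g\<close> by simp
    qed
    have nonexp: "norm y \<le> norm z"
      if "(norm y)\<^sup>2 \<le> g\<^sup>2 * (norm z)\<^sup>2 + (1 - g\<^sup>2) * (norm a)\<^sup>2" "g \<in> {0..<1}"
        "(norm a)\<^sup>2 \<le> (norm z)\<^sup>2" for y a :: 'h and g
    proof (rule power2_le_imp_le)
      have "g\<^sup>2 \<le> 1" using that(2) by (simp add: power_le_one)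
      then have "(norm y)\<^sup>2 \<le> g\<^sup>2 * (norm z)\<^sup>2 + (1 - g\<^sup>2) * (norm z)\<^sup>2"
        using that(1) mult_left_mono[OF that(3), of "1 - g\<^sup>2"] by linarith
      then show "(norm y)\<^sup>2 \<le> (norm z)\<^sup>2"
        by (simp add: algebra_simps)
    qed simp
    have G1: "(norm (G\<^sub>1 x - w))\<^sup>2 \<le> \<gamma>\<^sub>1\<^sup>2 * (norm z)\<^sup>2 + (1 - \<gamma>\<^sub>1\<^sup>2) * (norm u)\<^sup>2"
      unfolding z_def u_def by (rule BAM_norm_le[OF assms(3,6) w(1)])
    have G2: "(norm (G\<^sub>2 x - w))\<^sup>2 \<le> \<gamma>\<^sub>2\<^sup>2 * (norm z)\<^sup>2 + (1 - \<gamma>\<^sub>2\<^sup>2) * (norm v)\<^sup>2"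
      unfolding z_def v_def by (rule BAM_norm_le[OF assms(4,8) w(2)])
    have short: "(norm a)\<^sup>2 \<le> (norm z)\<^sup>2" if "(z - a) \<bullet> a = 0" for a
    proof -
      have "(norm z)\<^sup>2 = (norm a)\<^sup>2 + (norm (z - a))\<^sup>2"
        using that unfolding power2_norm_eq_inner by (simp add: inner_simps inner_commute)
      then show ?thesis by simp
    qed
    have "(norm u)\<^sup>2 \<le> (norm z)\<^sup>2" "(norm v)\<^sup>2 \<le> (norm z)\<^sup>2"
      using metric_proj_orthogonal[OF assms(5,6) uv(1), of x] short[of u]
        metric_proj_orthogonal[OF assms(7,8) uv(2), of x] short[of v]
      by (simp_all add: z_def u_def v_def)
    then have nx: "norm (G\<^sub>1 x - w) \<le> norm z" "norm (G\<^sub>2 x - w) \<le> norm z"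
      using nonexp G1 G2 assms(1,2) by blast+
    have "T x - w = \<alpha> *\<^sub>R (G\<^sub>1 x - w) + (1 - \<alpha>) *\<^sub>R (G\<^sub>2 x - w)"
      by (simp add: T_def algebra_simps)
    then have tri: "norm (T x - w) \<le> \<alpha> * norm (G\<^sub>1 x - w) + (1 - \<alpha>) * norm (G\<^sub>2 x - w)"
      using \<alpha> norm_triangle_ineq[of "\<alpha> *\<^sub>R (G\<^sub>1 x - w)" "(1 - \<alpha>) *\<^sub>R (G\<^sub>2 x - w)"] by simp
    \<comment> \<open>If both inequalities failed, adding their negations would contradict
      \<open>sum\<close>.\<close>
    consider "(norm u)\<^sup>2 \<le> (1 + c\<^sub>F) / 2 * (norm z)\<^sup>2" | "(norm v)\<^sup>2 \<le> (1 + c\<^sub>F) / 2 * (norm z)\<^sup>2"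
      using sum by (simp add: field_simps) linarith
    then have "norm (T x - w) \<le> \<gamma> * norm z"
    proof cases
      case 1
      then have "norm (G\<^sub>1 x - w) \<le> sqrt (q \<gamma>\<^sub>1) * norm z"
        using improved G1 assms(1) by blast
      \<comment> \<open>Only the first summand improves; for the second \<open>nx\<close> suffices,
        and the total is the first entry of the maximum.\<close>
      then have "norm (T x - w) \<le> \<alpha> * (sqrt (q \<gamma>\<^sub>1) * norm z) + (1 - \<alpha>) * norm z"
        using tri \<alpha> nx(2) by (smt (verit) mult_left_mono)
      also have "\<dots> = (\<alpha> * sqrt (q \<gamma>\<^sub>1) + (1 - \<alpha>)) * norm z"
        by (simp add: algebra_simps)
      also have "\<dots> \<le> \<gamma> * norm z"
        unfolding \<gamma> by (intro mult_right_mono) auto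
      finally show ?thesis .
    next
      case 2
      then have "norm (G\<^sub>2 x - w) \<le> sqrt (q \<gamma>\<^sub>2) * norm z"
        using improved G2 assms(2) by blast
      then have "norm (T x - w) \<le> \<alpha> * norm z + (1 - \<alpha>) * (sqrt (q \<gamma>\<^sub>2) * norm z)"
        using tri \<alpha> nx(1) by (smt (verit) mult_left_mono)
      also have "\<dots> = (\<alpha> + (1 - \<alpha>) * sqrt (q \<gamma>\<^sub>2)) * norm z"
        by (simp add: algebra_simps)
      also have "\<dots> \<le> \<gamma> * norm z"
        unfolding \<gamma> by (intro mult_right_mono) auto
      finally show ?thesis .
    qed
    then show ?thesis by (simp add: z_def w_def)
  qed
  have FixT: "Fix T = W"
  proof
    show "W \<subseteq> Fix T"
      by (auto simp: W_def Fix_def T_def simp flip: scaleR_add_left)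
    show "Fix T \<subseteq> W"
    proof
      fix x assume "x \<in> Fix T"
      \<comment> \<open>At a fixed point the estimate bounds the distance to \<open>W\<close> by
        \<open>\<gamma>\<close> times itself, and \<open>\<gamma> < 1\<close>.\<close>
      then have "(1 - \<gamma>) * norm (x - metric_proj W x) \<le> 0"
        using T_norm[of x] by (simp add: Fix_def algebra_simps)
      then have "x = metric_proj W x"
        using upper by (simp add: mult_le_0_iff)
      then show "x \<in> W" using projW[of x] by simp
    qed
  qed
  \<comment> \<open>\<open>T_orth\<close> says that the projection of \<open>x\<close> satisfies the
    characterisation of the projection of \<open>T x\<close>.\<close>
  have "metric_proj W (T x) = metric_proj W x" for x
    using metric_proj_unique[OF W projW T_orth] .
  then have "is_BAM \<gamma> T"
    unfolding is_BAM_def FixT using W T_norm nonneg upper subspace_0[OF W(2)] subspace_imp_convex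
    by (auto simp: fun_eq_iff)
  then show ?thesis
    using lower upper by (simp add: T_def[abs_def])
qed

end
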